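(* Consider the discrete-time switched linear control system $x(t+1)=A_{\sigma(t)}x(t)+B_{\sigma(t)}u(t)$ with $A_1,\dots,A_M\in\mathbb{R}^{n\times n}$, $B_1,\dots,B_M\in\mathbb{R}^{n\times m}$, and assume that the matrix $\bar B\in\mathbb{R}^{Mn\times m}$ obtained by stacking $B_1,\dots,B_M$ vertically satisfies $\operatorname{rank}(\bar B)=m$. Then the system admits arbitrarily fast mode-independent (respectively, mode-dependent) stabilization, i.e., $\rho_*^I=0$ (respectively, $\rho_*^D=0$), if and only if it is Mode-Independent Fixed-Time Stabilizable, MIFTS (respectively, Mode-Dependent Fixed-Time Stabilizable, MDFTS).
   Context: Notation: $\mathcal{M}=\{1,\dots,M\}$; $\mathbb{N}$ includes $0$; $\mathcal{S}$ is the set of all switching signals $\sigma:\mathbb{N}\to\mathcal{M}$; $\|\cdot\|$ is the Euclidean norm. For functions $\varphi_1,\dots,\varphi_M:\mathbb{R}^n\to\mathbb{R}^m$ (arbitrary, not necessarily linear), let $\Phi^D_\sigma(t,x_0)$ be the solution at time $t$ of $x(t+1)=A_{\sigma(t)}x(t)+B_{\sigma(t)}\varphi_{\sigma(t)}(x(t))$, $x(0)=x_0$. For a single function $\varphi:\mathbb{R}^n\to\mathbb{R}^m$, let $\Phi^I_\sigma(t,x_0)$ be the solution of $x(t+1)=A_{\sigma(t)}x(t)+B_{\sigma(t)}\varphi(x(t))$, $x(0)=x_0$. The constant $\rho\in[0,\infty)$ is an attainable growth rate by mode-dependent feedback if there exist $\varphi_1,\dots,\varphi_M$ and $C>0$ such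 that $\|\Phi^D_\sigma(t,x_0)\|\le C\rho^t\|x_0\|$ for all $t\in\mathbb{N}$, $x_0\in\mathbb{R}^n$, $\sigma\in\mathcal{S}$; it is attainable by mode-independent feedback if there exist $\varphi$ and $C>0$ such that $\|\Phi^I_\sigma(t,x_0)\|\le C\rho^t\|x_0\|$ for all such $t,x_0,\sigma$. The minimal growth rate $\rho_*^D$ (respectively, $\rho_*^I$) is the infimum of the growth rates attainable by mode-dependent (respectively, mode-independent) feedback. The system is MDFTS if there exist $\varphi_1,\dots,\varphi_M$ and $T\in\mathbb{N}$ such that $\Phi^D_\sigma(t,x_0)=0$ for all $t\ge T$, all $x_0\in\mathbb{R}^n$, all $\sigma\in\mathcal{S}$. It is MIFTS if there exist $\varphi$ and $T\in\mathbb{N}$ such that $\Phi^I_\sigma(t,x_0)=0$ for all $t\ge T$, all $x_0\in\mathbb{R}^n$, all $\sigma\in\mathcal{S}$. *)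

theory Defs
  imports "HOL-Analysis.Analysis"
begin

text \<open>
  The modes are the elements of a finite type \<open>'k\<close>, with \<open>M = CARD('k)\<close>; a switching signal is an
  arbitrary function \<open>nat \<Rightarrow> 'k\<close>. State and input dimensions are \<open>n = CARD('n)\<close> and \<open>m = CARD('m)\<close>.
\<close>

primrec sol_dep ::
  "('k \<Rightarrow> real^'n^'n) \<Rightarrow> ('k \<Rightarrow> real^'m^'n) \<Rightarrow> ('k \<Rightarrow> real^'n \<Rightarrow> real^'m) \<Rightarrow>
   (nat \<Rightarrow> 'k) \<Rightarrow> nat \<Rightarrow> real^'n \<Rightarrow> real^'n" where
  "sol_dep A B \<phi> \<sigma> 0 x0 = x0"
| "sol_dep A B \<phi> \<sigma> (Suc t) x0 =
     A (\<sigma> t) *v sol_dep A B \<phi> \<sigma> t x0 + B (\<sigma> t) *v \<phi> (\<sigma> t) (sol_dep A B \<phi> \<sigma> t x0)"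

primrec sol_indep ::
  "('k \<Rightarrow> real^'n^'n) \<Rightarrow> ('k \<Rightarrow> real^'m^'n) \<Rightarrow> (real^'n \<Rightarrow> real^'m) \<Rightarrow>
   (nat \<Rightarrow> 'k) \<Rightarrow> nat \<Rightarrow> real^'n \<Rightarrow> real^'n" where
  "sol_indep A B \<phi> \<sigma> 0 x0 = x0"
| "sol_indep A B \<phi> \<sigma> (Suc t) x0 =
     A (\<sigma> t) *v sol_indep A B \<phi> \<sigma> t x0 + B (\<sigma> t) *v \<phi> (sol_indep A B \<phi> \<sigma> t x0)"

definition attainable_rate_dep ::
  "('k::finite \<Rightarrow> real^'n^'n) \<Rightarrow> ('k \<Rightarrow> real^'m^'n) \<Rightarrow> real \<Rightarrow> bool" where
  "attainable_rate_dep A B \<rho> \<longleftrightarrow>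
     0 \<le> \<rho> \<and>
     (\<exists>(\<phi> :: 'k \<Rightarrow> real^'n \<Rightarrow> real^'m) C. C > 0 \<and>
        (\<forall>t x0 \<sigma>. norm (sol_dep A B \<phi> \<sigma> t x0) \<le> C * \<rho> ^ t * norm x0))"

definition attainable_rate_indep ::
  "('k::finite \<Rightarrow> real^'n^'n) \<Rightarrow> ('k \<Rightarrow> real^'m^'n) \<Rightarrow> real \<Rightarrow> bool" where
  "attainable_rate_indep A B \<rho> \<longleftrightarrow>
     0 \<le> \<rho> \<and>
     (\<exists>(\<phi> :: real^'n \<Rightarrow> real^'m) C. C > 0 \<and>
        (\<forall>t x0 \<sigma>. norm (sol_indep A B \<phi> \<sigma> t x0) \<le> C * \<rho> ^ t * norm x0))"

text \<open>
  Both infima are over nonempty sets of reals bounded below by \<open>0\<close>: with zero feedback, any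
  \<open>\<rho>\<close> at least as large as the operator norms of the finitely many \<open>A i\<close> is attainable.
\<close>

definition min_rate_dep ::
  "('k::finite \<Rightarrow> real^'n^'n) \<Rightarrow> ('k \<Rightarrow> real^'m^'n) \<Rightarrow> real" where
  "min_rate_dep A B = Inf {\<rho>. attainable_rate_dep A B \<rho>}"

definition min_rate_indep ::
  "('k::finite \<Rightarrow> real^'n^'n) \<Rightarrow> ('k \<Rightarrow> real^'m^'n) \<Rightarrow> real" where
  "min_rate_indep A B = Inf {\<rho>. attainable_rate_indep A B \<rho>}"

definition MDFTS ::
  "('k::finite \<Rightarrow> real^'n^'n) \<Rightarrow> ('k \<Rightarrow> real^'m^'n) \<Rightarrow> bool" where
  "MDFTS A B \<longleftrightarrow>
     (\<exists>(\<phi> :: 'k \<Rightarrow> real^'n \<Rightarrow> real^'m) T. \<forall>t\<ge>T. \<forall>x0 \<sigma>. sol_dep A B \<phi> \<sigma> t x0 = 0)"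

definition MIFTS ::
  "('k::finite \<Rightarrow> real^'n^'n) \<Rightarrow> ('k \<Rightarrow> real^'m^'n) \<Rightarrow> bool" where
  "MIFTS A B \<longleftrightarrow>
     (\<exists>(\<phi> :: real^'n \<Rightarrow> real^'m) T. \<forall>t\<ge>T. \<forall>x0 \<sigma>. sol_indep A B \<phi> \<sigma> t x0 = 0)"

text \<open>Vertical stacking: the \<open>Mn\<close> rows are indexed by pairs of a mode and a row of \<open>B i\<close>.\<close>

definition stack :: "('k::finite \<Rightarrow> real^'m^'n) \<Rightarrow> real^'m^('k \<times> 'n)" where
  "stack B = (\<chi> p. B (fst p) $ snd p)"

end

theory Submission
  imports Defs
begin

text \<open>
  Let \<open>V 0 = {0}\<close> and let \<open>V (k + 1)\<close> be the set of states from which a single input brings every mode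
  into \<open>V k\<close>. These are increasing subspaces, so they become stationary. If they reach the whole
  space, linear selections of the inputs, one on each layer, give a linearly bounded feedback that
  reaches \<open>0\<close> in fixed time, and hence every positive rate. If they become stationary at a proper
  subspace \<open>V\<close>, let \<open>p\<close> be linear with kernel \<open>V\<close>; since \<open>p (A i x + B i u) = 0\<close> for all \<open>i\<close> forces
  \<open>p x = 0\<close>, there is \<open>K\<close> such that for all \<open>x\<close> and \<open>u\<close> some mode satisfies
  \<open>norm (p x) \<le> K * norm (p (A i x + B i u))\<close>, and choosing such modes successively shows that no
  feedback attains a rate below \<open>1 / K\<close>. Mode-dependent feedback is mode-independent feedback for
  the system whose input is the family of the inputs of all modes.
\<close>

section \<open>The increasing chain of subspaces\<close>

primrec null_set ::
  "('k \<Rightarrow> real^'n^'n) \<Rightarrow> ('k \<Rightarrow> real^'m^'n) \<Rightarrow> nat \<Rightarrow> (real^'n) set" where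
  "null_set A B 0 = {0}"
| "null_set A B (Suc k) = {x. \<exists>u. \<forall>i. A i *v x + B i *v u \<in> null_set A B k}"

lemma linear_mode_step:
  fixes A :: "real^'n^'n" and B :: "real^'m^'n"
  shows "linear (\<lambda>z. A *v fst z + B *v snd z)"
  by (rule linearI) (simp_all add: matrix_vector_right_distrib matrix_vector_mult_scaleR scaleR_add_right)

lemma subspace_mode_steps:
  fixes A :: "'k \<Rightarrow> real^'n^'n" and B :: "'k \<Rightarrow> real^'m^'n"
  assumes "subspace V"
  shows "subspace {z. \<forall>i. A i *v fst z + B i *v snd z \<in> V}"
proof -
  have "{z. \<forall>i. A i *v fst z + B i *v snd z \<in> V}
      = \<Inter> (range (\<lambda>i. (\<lambda>z. A i *v fst z + B i *v snd z) -` V))"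
    by auto
  also have "subspace \<dots>"
    using assms by (intro subspace_Inter) (auto intro: linear_subspace_vimage linear_mode_step)
  finally show ?thesis .
qed

text \<open>Pairs of a state and a suitable input form a subspace, and forgetting the input is
  linear. This yields both the subspace property of each layer and a linear choice of
  inputs.\<close>

lemma null_set_Suc_eq_fst_image:
  "null_set A B (Suc k) = fst ` {z. \<forall>i. A i *v fst z + B i *v snd z \<in> null_set A B k}"
proof (intro set_eqI iffI)
  fix x assume "x \<in> null_set A B (Suc k)"
  then obtain u where "\<forall>i. A i *v x + B i *v u \<in> null_set A B k" by auto
  then show "x \<in> fst ` {z. \<forall>i. A i *v fst z + B i *v snd z \<in> null_set A B k}"
    by (intro image_eqI[of _ _ "(x, u)"]) simp_all
qed auto

lemma subspace_null_set: "subspace (null_set A B k)"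
proof (induction k)
  case (Suc k)
  then show ?case
    unfolding null_set_Suc_eq_fst_image
    by (intro linear_subspace_image subspace_mode_steps linear_fst)
qed simp

lemma null_set_le_Suc: "null_set A B k \<subseteq> null_set A B (Suc k)"
proof (induction k)
  case 0
  have "\<forall>i. A i *v 0 + B i *v 0 = 0" by simp
  then show ?case by (auto intro!: exI[of _ 0])
next
  case (Suc k)
  then show ?case by fastforce
qed

lemma null_set_mono: "j \<le> k \<Longrightarrow> null_set A B j \<subseteq> null_set A B k"
  by (rule lift_Suc_mono_le[of "null_set A B"]) (rule null_set_le_Suc)

lemma null_set_stationary:
  fixes A :: "'k \<Rightarrow> real^'n^'n" and B :: "'k \<Rightarrow> real^'m^'n"
  obtains k where "null_set A B (Suc k) = null_set A B k"
proof (rule ccontr)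
  assume "\<not> thesis"
  then have ne: "null_set A B (Suc k) \<noteq> null_set A B k" for k
    using that by blast
  have "dim (null_set A B k) < dim (null_set A B (Suc k))" for k
    using ne[of k] subspace_dim_equal[OF subspace_null_set subspace_null_set null_set_le_Suc, of A B k]
      dim_subset[OF null_set_le_Suc, of A B k] by (metis linorder_not_le)
  then have "strict_mono (\<lambda>k. dim (null_set A B k))"
    by (simp add: strict_mono_Suc_iff)
  \<comment> \<open>A strictly increasing sequence of naturals dominates its index; the index one
    above the dimension gives the contradiction.\<close>
  then have "Suc (DIM(real^'n)) \<le> dim (null_set A B (Suc (DIM(real^'n))))"
    by (rule strict_mono_imp_increasing)
  then show False
    using dim_subset_UNIV[of "null_set A B (Suc (DIM(real^'n)))"] by linarith
qed

section \<open>Feedbacks that reach zero in fixed time\<close>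

text \<open>The defining recursion splits off the last step. Arguments that choose the first mode
  and then continue from the new state need the first step split off instead.\<close>

lemma sol_indep_Suc_shift:
  "sol_indep A B \<phi> \<sigma> (Suc t) x0
     = sol_indep A B \<phi> (\<lambda>s. \<sigma> (Suc s)) t (A (\<sigma> 0) *v x0 + B (\<sigma> 0) *v \<phi> x0)"
  by (induction t) auto

text \<open>The input \<open>\<phi> x0\<close> is fixed before the mode is known, so it is a common
  witness for all modes; any signal may follow the first mode, which
  \<open>case_nat i \<sigma>\<close> prepends.\<close>

lemma sol_indep_zero_imp_null_set:
  "(\<And>\<sigma>. sol_indep A B \<phi> \<sigma> t x0 = 0) \<Longrightarrow> x0 \<in> null_set A B t"
proof (induction t arbitrary: x0)
  case 0
  then show ?case by simp
next
  case (Suc t)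
  have "A i *v x0 + B i *v \<phi> x0 \<in> null_set A B t" for i
  proof (rule Suc.IH)
    fix \<sigma>
    show "sol_indep A B \<phi> \<sigma> t (A i *v x0 + B i *v \<phi> x0) = 0"
      using Suc.prems[of "case_nat i \<sigma>"] unfolding sol_indep_Suc_shift by simp
  qed
  then show ?case by auto
qed

text \<open>A linear right inverse of \<open>fst\<close> on the subspace of admissible pairs has the
  chosen input as its second component.\<close>

lemma null_set_linear_selection:
  fixes A :: "'k \<Rightarrow> real^'n^'n" and B :: "'k \<Rightarrow> real^'m^'n"
  obtains h :: "real^'n \<Rightarrow> real^'m" where "linear h"
    "\<And>x i. x \<in> null_set A B (Suc k) \<Longrightarrow> A i *v x + B i *v h x \<in> null_set A B k"
proof -
  let ?S = "{z. \<forall>i. A i *v fst z + B i *v snd z \<in> null_set A B k}"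
  obtain g where g: "linear g" "range g \<subseteq> ?S" "\<forall>x\<in>fst ` ?S. fst (g x) = x"
    using linear_exists_right_inverse_on[OF linear_fst subspace_mode_steps[OF subspace_null_set]]
    by blast
  show thesis
  proof
    show "linear (\<lambda>x. snd (g x))"
      using linear_compose[OF g(1) linear_snd] by (simp add: o_def)
    fix x i assume "x \<in> null_set A B (Suc k)"
    then have "fst (g x) = x" using g(3) unfolding null_set_Suc_eq_fst_image by blast
    moreover have "g x \<in> ?S" using g(2) by blast
    ultimately show "A i *v x + B i *v snd (g x) \<in> null_set A B k" by auto
  qed
qed

text \<open>Each state uses the linear selection of the lowest layer containing it. One feedback
  thus serves all layers, and only finitely many selections occur, which bounds it linearly although
  it need not be linear.\<close>

lemma bounded_null_feedback:
  fixes A :: "'k \<Rightarrow> real^'n^'n" and B :: "'k \<Rightarrow> real^'m^'n"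
  assumes "null_set A B T = UNIV"
  obtains \<phi> :: "real^'n \<Rightarrow> real^'m" and c where
    "\<And>x. norm (\<phi> x) \<le> c * norm x"
    "\<And>x i k. x \<in> null_set A B (Suc k) \<Longrightarrow> A i *v x + B i *v \<phi> x \<in> null_set A B k"
proof -
  have "\<exists>h. linear h \<and>
      (\<forall>x i. x \<in> null_set A B (Suc k) \<longrightarrow> A i *v x + B i *v h x \<in> null_set A B k)" for k
    using null_set_linear_selection[of A B k] by metis
  then obtain h where lin: "\<And>k. linear (h k)"
    and h: "\<And>k x i. x \<in> null_set A B (Suc k) \<Longrightarrow> A i *v x + B i *v h k x \<in> null_set A B k"
    by metis
  obtain b where b: "\<And>k x. norm (h k x) \<le> b k * norm x" and "\<And>k. 0 < b k"
  proof -
    have "\<exists>c>0. \<forall>x. norm (h k x) \<le> c * norm x" for k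
      using linear_bounded_pos[OF lin[of k]] by metis
    then show thesis using that by metis
  qed
  define level where "level x = (LEAST k. x \<in> null_set A B k)" for x
  \<comment> \<open>\<open>h k\<close> leads from layer \<open>k + 1\<close> to layer
    \<open>k\<close>, hence the shift by one. Level 0 contains only \<open>x = 0\<close>, where
    truncated subtraction selects \<open>h 0\<close> and linearity gives input 0.\<close>
  define \<phi> where "\<phi> x = h (level x - 1) x" for x
  have level: "x \<in> null_set A B (level x)" for x
    unfolding level_def by (rule LeastI[of _ T]) (simp add: assms)
  have level_le: "level x \<le> k" if "x \<in> null_set A B k" for x k
    unfolding level_def using that by (rule Least_le)
  show thesis
  proof
    fix x
    have "b (level x - 1) \<le> sum b {..T}"
      using level_le[of x T] assms \<open>\<And>k. 0 < b k\<close> by (intro member_le_sum) (auto intro: less_imp_le)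
    then show "norm (\<phi> x) \<le> sum b {..T} * norm x"
      unfolding \<phi>_def using b order_trans mult_right_mono norm_ge_zero by meson
  next
    fix x i k assume x: "x \<in> null_set A B (Suc k)"
    show "A i *v x + B i *v \<phi> x \<in> null_set A B k"
    proof (cases "level x")
      case 0
      then have "x = 0" using level[of x] by simp
      then show ?thesis
        unfolding \<phi>_def using lin by (simp add: linear_0 subspace_0 subspace_null_set)
    next
      case (Suc j)
      then have "A i *v x + B i *v \<phi> x \<in> null_set A B j"
        using h[of x j i] level[of x] unfolding \<phi>_def by simp
      moreover have "j \<le> k" using level_le[OF x] Suc by simp
      ultimately show ?thesis using null_set_mono by blast
    qed
  qed
qed

lemma null_feedback_sol_zero:
  assumes "null_set A B T = UNIV"
    and "\<And>x i k. x \<in> null_set A B (Suc k) \<Longrightarrow> A i *v x + B i *v \<phi> x \<in> null_set A B k"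
    and "T \<le> t"
  shows "sol_indep A B \<phi> \<sigma> t x0 = 0"
proof -
  \<comment> \<open>Each step descends one layer, starting from layer \<open>N\<close>, which is the
    whole space. Taking \<open>N = t\<close> at the end leaves layer 0.\<close>
  have "sol_indep A B \<phi> \<sigma> t x0 \<in> null_set A B (N - t)" if "t \<le> N" "T \<le> N" for N
    using that(1)
  proof (induction t)
    case 0
    then show ?case using null_set_mono[OF that(2), of A B] assms(1) by auto
  next
    case (Suc t)
    then have "sol_indep A B \<phi> \<sigma> t x0 \<in> null_set A B (Suc (N - Suc t))"
      by (simp add: Suc_diff_Suc)
    from assms(2)[OF this] show ?case by simp
  qed
  from this[of t] show ?thesis using assms(3) by simp
qed

lemma MIFTS_iff_null_set:
  fixes A :: "'k::finite \<Rightarrow> real^'n^'n" and B :: "'k \<Rightarrow> real^'m^'n"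
  shows "MIFTS A B \<longleftrightarrow> (\<exists>T. null_set A B T = UNIV)"
proof
  assume "MIFTS A B"
  then show "\<exists>T. null_set A B T = UNIV"
    unfolding MIFTS_def using sol_indep_zero_imp_null_set[of A B] by blast
next
  assume "\<exists>T. null_set A B T = UNIV"
  then obtain T where T: "null_set A B T = UNIV" ..
  obtain \<phi> c where "\<And>x i k. x \<in> null_set A B (Suc k) \<Longrightarrow> A i *v x + B i *v \<phi> x \<in> null_set A B k"
    using bounded_null_feedback[OF T] by metis
  from null_feedback_sol_zero[OF T this] show "MIFTS A B"
    unfolding MIFTS_def by blast
qed

section \<open>Growth bounds and attainable rates\<close>

lemma sol_indep_norm_bound:
  fixes A :: "'k::finite \<Rightarrow> real^'n^'n" and B :: "'k \<Rightarrow> real^'m^'n"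
  assumes "\<And>x. norm (\<phi> x) \<le> c * norm x"
  obtains L where "0 < L" "\<And>\<sigma> t x0. norm (sol_indep A B \<phi> \<sigma> t x0) \<le> L ^ t * norm x0"
proof -
  have bound: "\<exists>c>0. \<forall>x. norm (X *v x) \<le> c * norm x" for X :: "real^'p^'q"
    using linear_bounded_pos[OF matrix_vector_mul_linear[of X]] by metis
  obtain a where a: "\<And>i x. norm (A i *v x) \<le> a i * norm x" and a0: "\<And>i. 0 < a i"
    using bound[of "A _"] by metis
  obtain b where b: "\<And>i x. norm (B i *v x) \<le> b i * norm x" and b0: "\<And>i. 0 < b i"
    using bound[of "B _"] by metis
  \<comment> \<open>The sum over the finitely many modes dominates each one-step gain;
    \<open>\<bar>c\<bar>\<close> is taken because \<open>c\<close> carries no sign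
    condition.\<close>
  define L where "L = 1 + (\<Sum>i\<in>UNIV. a i + b i * \<bar>c\<bar>)"
  have nonneg: "0 \<le> a i + b i * \<bar>c\<bar>" for i using a0[of i] b0[of i] by simp
  have "0 \<le> (\<Sum>i\<in>UNIV. a i + b i * \<bar>c\<bar>)" by (intro sum_nonneg nonneg)
  then have "0 < L" by (simp add: L_def)
  have step: "norm (A i *v x + B i *v \<phi> x) \<le> L * norm x" for i x
  proof -
    have "a i + b i * \<bar>c\<bar> \<le> (\<Sum>i\<in>UNIV. a i + b i * \<bar>c\<bar>)"
      by (rule member_le_sum) (auto intro: nonneg)
    then have le: "a i + b i * \<bar>c\<bar> \<le> L" by (simp add: L_def)
    have "norm (\<phi> x) \<le> \<bar>c\<bar> * norm x"
      using assms[of x] by (meson abs_ge_self mult_right_mono norm_ge_zero order_trans)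
    then have "norm (B i *v \<phi> x) \<le> b i * (\<bar>c\<bar> * norm x)"
      using b[of i "\<phi> x"] b0[of i] by (meson less_imp_le mult_left_mono order_trans)
    then have "norm (A i *v x + B i *v \<phi> x) \<le> (a i + b i * \<bar>c\<bar>) * norm x"
      using norm_triangle_ineq[of "A i *v x" "B i *v \<phi> x"] a[of i x] by (simp add: algebra_simps)
    also have "\<dots> \<le> L * norm x" by (intro mult_right_mono le) simp
    finally show ?thesis .
  qed
  have "norm (sol_indep A B \<phi> \<sigma> t x0) \<le> L ^ t * norm x0" for \<sigma> t x0
  proof (induction t)
    case (Suc t)
    have "norm (sol_indep A B \<phi> \<sigma> (Suc t) x0) \<le> L * norm (sol_indep A B \<phi> \<sigma> t x0)"
      by (simp add: step)
    also have "\<dots> \<le> L * (L ^ t * norm x0)"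
      using Suc \<open>0 < L\<close> by simp
    finally show ?case by (simp add: mult.assoc)
  qed simp
  with \<open>0 < L\<close> show thesis by (rule that)
qed

text \<open>Zero feedback already has a finite growth rate. Nonemptiness lets an attainable rate be
  extracted below any bound exceeding the infimum.\<close>

lemma attainable_rate_indep_nonempty: "\<exists>\<rho>. attainable_rate_indep A B \<rho>"
proof -
  obtain L where "0 < L" "\<And>\<sigma> t x0. norm (sol_indep A B (\<lambda>_. 0) \<sigma> t x0) \<le> L ^ t * norm x0"
    using sol_indep_norm_bound[of "\<lambda>_. 0" 0 A B] by auto
  then have "attainable_rate_indep A B L"
    unfolding attainable_rate_indep_def by (intro conjI exI[of _ "\<lambda>_. 0"] exI[of _ 1]) auto
  then show ?thesis ..
qed

lemma attainable_rate_indep_if_null_set: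
  fixes A :: "'k::finite \<Rightarrow> real^'n^'n" and B :: "'k \<Rightarrow> real^'m^'n"
  assumes T: "null_set A B T = UNIV" and "0 < \<rho>"
  shows "attainable_rate_indep A B \<rho>"
proof -
  obtain \<phi> c where c: "\<And>x. norm (\<phi> x) \<le> c * norm x"
    and null: "\<And>x i k. x \<in> null_set A B (Suc k) \<Longrightarrow> A i *v x + B i *v \<phi> x \<in> null_set A B k"
    using bounded_null_feedback[OF T] by metis
  obtain L where "0 < L" and L: "\<And>\<sigma> t x0. norm (sol_indep A B \<phi> \<sigma> t x0) \<le> L ^ t * norm x0"
    using sol_indep_norm_bound[OF c] by metis
  \<comment> \<open>Only times up to \<open>T\<close> matter, since the solution vanishes
    afterwards; \<open>C\<close> absorbs the ratios of \<open>L ^ t\<close> to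
    \<open>\<rho> ^ t\<close> there.\<close>
  define C where "C = (\<Sum>t\<le>T. (L / \<rho>) ^ t)"
  have C: "(L / \<rho>) ^ t \<le> C" if "t \<le> T" for t
    unfolding C_def using that \<open>0 < L\<close> \<open>0 < \<rho>\<close> by (intro member_le_sum) auto
  have "0 < C" using C[of 0] by simp
  have "norm (sol_indep A B \<phi> \<sigma> t x0) \<le> C * \<rho> ^ t * norm x0" for \<sigma> t x0
  proof (cases "t \<le> T")
    case True
    have "L ^ t \<le> C * \<rho> ^ t"
      using C[OF True] \<open>0 < \<rho>\<close> by (simp add: power_divide pos_divide_le_eq)
    then show ?thesis
      using L[of \<sigma> t x0] by (meson mult_right_mono norm_ge_zero order_trans)
  next
    case False
    then have "sol_indep A B \<phi> \<sigma> t x0 = 0"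
      using null_feedback_sol_zero[OF T null] by simp
    then show ?thesis using \<open>0 < C\<close> \<open>0 < \<rho>\<close> by simp
  qed
  then show ?thesis
    unfolding attainable_rate_indep_def using \<open>0 < C\<close> \<open>0 < \<rho>\<close> less_imp_le by blast
qed

section \<open>Lower bound on the rate at a proper stationary subspace\<close>

text \<open>The kernel condition makes \<open>H\<close> factor through \<open>F\<close>: with
  \<open>g\<close> a right inverse of \<open>F\<close> on its range, \<open>H\<close> equals
  \<open>H\<close> after \<open>g\<close> after \<open>F\<close>, and \<open>H\<close> after
  \<open>g\<close> is bounded.\<close>

lemma linear_kernel_bound:
  fixes F :: "'a::euclidean_space \<Rightarrow> 'b::euclidean_space" and H :: "'a \<Rightarrow> 'c::euclidean_space"
  assumes F: "linear F" and H: "linear H" and ker: "\<And>z. F z = 0 \<Longrightarrow> H z = 0"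
  obtains K where "0 < K" "\<And>z. norm (H z) \<le> K * norm (F z)"
proof -
  obtain g where g: "linear g" "\<forall>y\<in>range F. F (g y) = y"
    using linear_exists_right_inverse_on[OF F subspace_UNIV] by blast
  obtain K where "0 < K" and K: "\<And>y. norm (H (g y)) \<le> K * norm y"
    using linear_bounded_pos[OF linear_compose[OF g(1) H]] by auto
  have "F (z - g (F z)) = 0" for z
    using g(2) by (simp add: linear_diff[OF F])
  then have "H (z - g (F z)) = 0" for z by (rule ker)
  then have "H z = H (g (F z))" for z by (simp add: linear_diff[OF H])
  then have "norm (H z) \<le> K * norm (F z)" for z using K[of "F z"] by metis
  with \<open>0 < K\<close> show thesis by (rule that)
qed

text \<open>A linear \<open>g\<close> into \<open>V\<close> that fixes \<open>V\<close> pointwise is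
  a projection onto \<open>V\<close>; the complementary projection has kernel
  \<open>V\<close>.\<close>

lemma subspace_eq_kernel:
  fixes V :: "'a::euclidean_space set"
  assumes "subspace V"
  obtains p :: "'a \<Rightarrow> 'a" where "linear p" "\<And>x. p x = 0 \<longleftrightarrow> x \<in> V"
proof -
  obtain g where g: "linear g" "range g \<subseteq> V" "\<forall>x\<in>id ` V. id (g x) = x"
    using linear_exists_right_inverse_on[OF linear_id assms] by blast
  show thesis
  proof
    show "linear (\<lambda>x. x - g x)" by (intro linear_compose_sub linear_ident g(1))
    show "x - g x = 0 \<longleftrightarrow> x \<in> V" for x using g(2,3) by force
  qed
qed

text \<open>\<open>F\<close> collects the values of \<open>p\<close> after one step in all modes. If
  \<open>F\<close> vanishes, the state lies in layer \<open>k + 1\<close>, which by stationarity is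
  layer \<open>k\<close>, the kernel of \<open>p\<close>; so \<open>F\<close> controls
  \<open>p\<close> of the state.\<close>

lemma stationary_null_set_escape:
  fixes A :: "'k::finite \<Rightarrow> real^'n^'n" and B :: "'k \<Rightarrow> real^'m^'n"
  assumes "null_set A B (Suc k) = null_set A B k"
  obtains p :: "real^'n \<Rightarrow> real^'n" and K where
    "linear p" "\<And>x. p x = 0 \<longleftrightarrow> x \<in> null_set A B k" "0 < K"
    "\<And>x u. \<exists>i. norm (p x) \<le> K * norm (p (A i *v x + B i *v u))"
proof -
  obtain p :: "real^'n \<Rightarrow> real^'n"
    where p: "linear p" and ker: "\<And>x. p x = 0 \<longleftrightarrow> x \<in> null_set A B k"
    using subspace_eq_kernel[OF subspace_null_set] by metis
  define F :: "(real^'n) \<times> (real^'m) \<Rightarrow> (real^'n)^'k"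
    where "F z = (\<chi> i. p (A i *v fst z + B i *v snd z))" for z
  have comp: "linear (\<lambda>z. p (A i *v fst z + B i *v snd z))" for i
    using linear_compose[OF linear_mode_step p] by (simp add: o_def)
  have "linear F"
    by (rule linearI) (simp_all add: F_def vec_eq_iff linear_add[OF comp, simplified]
        linear_scale[OF comp, simplified])
  moreover have "linear (\<lambda>z :: (real^'n) \<times> (real^'m). p (fst z))"
    using linear_compose[OF linear_fst p] by (simp add: o_def)
  moreover have "p (fst z) = 0" if "F z = 0" for z
  proof -
    have "\<forall>i. A i *v fst z + B i *v snd z \<in> null_set A B k"
    proof
      fix i
      have "p (A i *v fst z + B i *v snd z) = F z $ i" by (simp add: F_def)
      then show "A i *v fst z + B i *v snd z \<in> null_set A B k"
        using that by (simp flip: ker)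
    qed
    then have "fst z \<in> null_set A B (Suc k)" by auto
    then show ?thesis unfolding ker assms .
  qed
  ultimately obtain K where "0 < K" and K: "\<And>z. norm (p (fst z)) \<le> K * norm (F z)"
    using linear_kernel_bound[of F "\<lambda>z. p (fst z)"] by metis
  \<comment> \<open>Averaging: the norm of \<open>F\<close> is at most the sum over the modes, so
    some mode carries at least a share \<open>1 / CARD('k)\<close>.\<close>
  have "\<exists>i. norm (p x) \<le> (K * CARD('k)) * norm (p (A i *v x + B i *v u))" for x u
  proof (rule ccontr)
    assume "\<not> ?thesis"
    then have less: "K * CARD('k) * norm (p (A i *v x + B i *v u)) < norm (p x)" for i
      by (simp add: not_le)
    have "norm (F (x, u)) \<le> (\<Sum>i\<in>UNIV. norm (F (x, u) $ i))"
      unfolding norm_vec_def by (rule L2_set_le_sum) simp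
    then have "norm (F (x, u)) \<le> (\<Sum>i\<in>UNIV. norm (p (A i *v x + B i *v u)))"
      by (simp add: F_def)
    then have "K * norm (F (x, u)) \<le> K * (\<Sum>i\<in>UNIV. norm (p (A i *v x + B i *v u)))"
      using \<open>0 < K\<close> by simp
    then have "norm (p x) \<le> K * (\<Sum>i\<in>UNIV. norm (p (A i *v x + B i *v u)))"
      using K[of "(x, u)"] by simp
    then have "CARD('k) * norm (p x)
        \<le> CARD('k) * (K * (\<Sum>i\<in>UNIV. norm (p (A i *v x + B i *v u))))"
      by (rule mult_left_mono) simp
    also have "\<dots> = (\<Sum>i\<in>UNIV. K * CARD('k) * norm (p (A i *v x + B i *v u)))"
      by (simp only: sum_distrib_left mult_ac)
    also have "\<dots> < (\<Sum>i\<in>(UNIV :: 'k set). norm (p x))"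
      by (intro sum_strict_mono less) auto
    finally show False by simp
  qed
  moreover have "0 < K * CARD('k)" using \<open>0 < K\<close> by simp
  ultimately show thesis using that p ker by blast
qed

text \<open>The adversary reacts to the feedback: it picks a good mode for the current state and
  continues inductively from the state reached.\<close>

lemma escaping_signal:
  fixes A :: "'k \<Rightarrow> real^'n^'n" and B :: "'k \<Rightarrow> real^'m^'n" and p :: "real^'n \<Rightarrow> real^'n"
  assumes "0 < K" and K: "\<And>x u. \<exists>i. norm (p x) \<le> K * norm (p (A i *v x + B i *v u))"
  shows "\<exists>\<sigma>. norm (p x0) \<le> K ^ t * norm (p (sol_indep A B \<phi> \<sigma> t x0))"
proof (induction t arbitrary: x0)
  case 0
  show ?case by simp
next
  case (Suc t)
  obtain i where i: "norm (p x0) \<le> K * norm (p (A i *v x0 + B i *v \<phi> x0))"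
    using K by blast
  obtain \<sigma> where "norm (p (A i *v x0 + B i *v \<phi> x0))
      \<le> K ^ t * norm (p (sol_indep A B \<phi> \<sigma> t (A i *v x0 + B i *v \<phi> x0)))"
    using Suc.IH by blast
  then have "norm (p x0) \<le> K * (K ^ t * norm (p (sol_indep A B \<phi> (case_nat i \<sigma>) (Suc t) x0)))"
    unfolding sol_indep_Suc_shift using i \<open>0 < K\<close>
    by simp (meson less_imp_le mult_left_mono order_trans)
  then show ?case by (metis mult.assoc power_Suc)
qed

lemma null_set_UNIV_if_min_rate_zero:
  fixes A :: "'k::finite \<Rightarrow> real^'n^'n" and B :: "'k \<Rightarrow> real^'m^'n"
  assumes "min_rate_indep A B = 0"
  shows "\<exists>T. null_set A B T = UNIV"
proof -
  obtain k where k: "null_set A B (Suc k) = null_set A B k"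
    using null_set_stationary .
  obtain p :: "real^'n \<Rightarrow> real^'n" and K where p: "linear p"
    and ker: "\<And>x. p x = 0 \<longleftrightarrow> x \<in> null_set A B k" and "0 < K"
    and K: "\<And>x u. \<exists>i. norm (p x) \<le> K * norm (p (A i *v x + B i *v u))"
    using stationary_null_set_escape[OF k] by metis
  obtain d where "0 < d" and d: "\<And>x. norm (p x) \<le> d * norm x"
    using linear_bounded_pos[OF p] by blast
  \<comment> \<open>The factor 2 leaves a margin: the escape factor \<open>K ^ t\<close> times the
    decay \<open>\<rho> ^ t\<close> is then at most \<open>(1 / 2) ^ t\<close>.\<close>
  have "Inf {\<rho>. attainable_rate_indep A B \<rho>} < 1 / (2 * K)"
    using assms \<open>0 < K\<close> by (simp add: min_rate_indep_def)
  then obtain \<rho> where "attainable_rate_indep A B \<rho>" "\<rho> < 1 / (2 * K)"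
    using cInf_lessD[of "{\<rho>. attainable_rate_indep A B \<rho>}"] attainable_rate_indep_nonempty[of A B]
    by auto
  then obtain \<phi> C where "0 \<le> \<rho>" "0 < C"
    and C: "\<And>t x0 \<sigma>. norm (sol_indep A B \<phi> \<sigma> t x0) \<le> C * \<rho> ^ t * norm x0"
    unfolding attainable_rate_indep_def by blast
  have half: "K * \<rho> \<le> 1 / 2"
    using \<open>\<rho> < 1 / (2 * K)\<close> \<open>0 < K\<close> by (simp add: field_simps)
  have "x0 \<in> null_set A B k" for x0
  proof -
    have "norm (p x0) \<le> (d * C * norm x0) * (1 / 2) ^ t" for t
    proof -
      \<comment> \<open>The signal may change with \<open>t\<close>, because \<open>C\<close> is
        uniform over all signals.\<close>
      obtain \<sigma> where \<sigma>: "norm (p x0) \<le> K ^ t * norm (p (sol_indep A B \<phi> \<sigma> t x0))"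
        using escaping_signal[where p = p, OF \<open>0 < K\<close> K] by blast
      also have "\<dots> \<le> K ^ t * (d * (C * \<rho> ^ t * norm x0))"
        using \<open>0 < K\<close> \<open>0 < d\<close> d C by (meson less_imp_le mult_left_mono order_trans zero_le_power)
      also have "\<dots> = (d * C * norm x0) * (K * \<rho>) ^ t"
        by (simp add: power_mult_distrib)
      also have "\<dots> \<le> (d * C * norm x0) * (1 / 2) ^ t"
        using half \<open>0 < K\<close> \<open>0 < d\<close> \<open>0 < C\<close> \<open>0 \<le> \<rho>\<close>
        by (intro mult_left_mono power_mono) auto
      finally show ?thesis .
    qed
    moreover have "(\<lambda>t. (d * C * norm x0) * (1 / 2) ^ t) \<longlonglongrightarrow> (d * C * norm x0) * 0"
      by (intro tendsto_mult tendsto_const LIMSEQ_power_zero) simp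
    ultimately have "norm (p x0) \<le> (d * C * norm x0) * 0"
      by (intro LIMSEQ_le_const) auto
    then show ?thesis using ker by simp
  qed
  then show ?thesis by blast
qed

text \<open>For the converse, rate 0 itself need not be attainable; the infimum is 0 because every
  positive rate is.\<close>

lemma min_rate_indep_zero_iff_MIFTS:
  fixes A :: "'k::finite \<Rightarrow> real^'n^'n" and B :: "'k \<Rightarrow> real^'m^'n"
  shows "min_rate_indep A B = 0 \<longleftrightarrow> MIFTS A B"
proof
  assume "min_rate_indep A B = 0"
  then show "MIFTS A B"
    by (simp add: MIFTS_iff_null_set null_set_UNIV_if_min_rate_zero)
next
  assume "MIFTS A B"
  then obtain T where "null_set A B T = UNIV"
    by (auto simp: MIFTS_iff_null_set)
  then have pos: "attainable_rate_indep A B \<rho>" if "0 < \<rho>" for \<rho>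
    using attainable_rate_indep_if_null_set that by blast
  have nonneg: "0 \<le> \<rho>" if "attainable_rate_indep A B \<rho>" for \<rho>
    using that by (simp add: attainable_rate_indep_def)
  show "min_rate_indep A B = 0"
    unfolding min_rate_indep_def
  proof (rule cInf_eq)
    fix y assume y: "\<And>\<rho>. \<rho> \<in> {\<rho>. attainable_rate_indep A B \<rho>} \<Longrightarrow> y \<le> \<rho>"
    show "y \<le> 0" by (rule field_le_epsilon) (use y pos in auto)
  qed (use nonneg in auto)
qed

section \<open>Reduction of mode-dependent to mode-independent feedback\<close>

text \<open>A block row with \<open>B i\<close> in block \<open>i\<close> and zeros elsewhere: the
  enlarged input carries one proposal per mode, and the active mode reads only its own.\<close>

definition joint_input :: "('k::finite \<Rightarrow> real^'m^'n) \<Rightarrow> 'k \<Rightarrow> real^('k \<times> 'm)^'n" where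
  "joint_input B i = (\<chi> r p. if fst p = i then B i $ r $ snd p else 0)"

lemma joint_input_mult: "joint_input B i *v w = B i *v (\<chi> j. w $ (i, j))"
proof -
  have "(\<Sum>p\<in>UNIV. (if fst p = i then B i $ r $ snd p else 0) * w $ p)
      = (\<Sum>j\<in>UNIV. B i $ r $ j * w $ (i, j))" for r
  proof -
    have "(\<Sum>p\<in>UNIV. (if fst p = i then B i $ r $ snd p else 0) * w $ p)
        = (\<Sum>l\<in>UNIV. \<Sum>j\<in>UNIV. if l = i then B i $ r $ j * w $ (i, j) else 0)"
      unfolding UNIV_Times_UNIV[symmetric] sum.cartesian_product[symmetric]
      by (auto simp: sum.cartesian_product intro!: sum.cong)
    also have "\<dots> = (\<Sum>j\<in>UNIV. B i $ r $ j * w $ (i, j))"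
      by (subst sum.swap) simp
    finally show ?thesis .
  qed
  then show ?thesis
    by (simp add: joint_input_def matrix_vector_mult_def vec_eq_iff)
qed

lemma sol_indep_joint_input:
  "sol_indep A (joint_input B) \<psi> \<sigma> t x0 = sol_dep A B (\<lambda>i x. \<chi> j. \<psi> x $ (i, j)) \<sigma> t x0"
  by (induction t) (simp_all add: joint_input_mult)

text \<open>Currying matches the feedbacks of the two systems with equal solutions. The predicate
  \<open>P\<close> on solution maps allows the transfer of both growth rates and fixed-time
  stabilization.\<close>

lemma ex_joint_input_feedback:
  "(\<exists>\<psi>. P (sol_indep A (joint_input B) \<psi>)) \<longleftrightarrow> (\<exists>\<phi>. P (sol_dep A B \<phi>))"
proof
  assume "\<exists>\<psi>. P (sol_indep A (joint_input B) \<psi>)"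
  then obtain \<psi> where P: "P (sol_indep A (joint_input B) \<psi>)" ..
  have "sol_indep A (joint_input B) \<psi> = sol_dep A B (\<lambda>i x. \<chi> j. \<psi> x $ (i, j))"
    by (intro ext) (rule sol_indep_joint_input)
  with P show "\<exists>\<phi>. P (sol_dep A B \<phi>)" by auto
next
  assume "\<exists>\<phi>. P (sol_dep A B \<phi>)"
  then obtain \<phi> where P: "P (sol_dep A B \<phi>)" ..
  have "sol_dep A B \<phi> = sol_indep A (joint_input B) (\<lambda>x. \<chi> p. \<phi> (fst p) x $ snd p)"
    by (intro ext) (simp add: sol_indep_joint_input)
  with P show "\<exists>\<psi>. P (sol_indep A (joint_input B) \<psi>)" by auto
qed

lemma attainable_rate_joint_input:
  "attainable_rate_indep A (joint_input B) \<rho> \<longleftrightarrow> attainable_rate_dep A B \<rho>"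
  unfolding attainable_rate_indep_def attainable_rate_dep_def
  using ex_joint_input_feedback[where A = A and B = B and
      P = "\<lambda>s. \<exists>C>0. \<forall>t x0 \<sigma>. norm (s \<sigma> t x0) \<le> C * \<rho> ^ t * norm x0"]
  by simp

lemma MIFTS_joint_input: "MIFTS A (joint_input B) \<longleftrightarrow> MDFTS A B"
  unfolding MIFTS_def MDFTS_def
  by (rule ex_joint_input_feedback[where P = "\<lambda>s. \<exists>T. \<forall>t\<ge>T. \<forall>x0 \<sigma>. s \<sigma> t x0 = 0"])

theorem theorem4:
  fixes A :: "'k::finite \<Rightarrow> real^'n^'n"
    and B :: "'k \<Rightarrow> real^'m^'n"
  assumes "rank (stack B) = CARD('m)"
  shows "(min_rate_indep A B = 0 \<longleftrightarrow> MIFTS A B) \<and> (min_rate_dep A B = 0 \<longleftrightarrow> MDFTS A B)"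
proof
  show "min_rate_indep A B = 0 \<longleftrightarrow> MIFTS A B"
    by (rule min_rate_indep_zero_iff_MIFTS)
  show "min_rate_dep A B = 0 \<longleftrightarrow> MDFTS A B"
    using min_rate_indep_zero_iff_MIFTS[of A "joint_input B"]
    by (simp add: min_rate_indep_def min_rate_dep_def attainable_rate_joint_input MIFTS_joint_input)
qed

end
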